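(* For every natural number $n \geq 1$, $$\pi((n+1)^2) - \pi(n^2) = \pi(2n) - \pi(n) + 1 - \phi_T(n^2, 2n, \pi(n)).$$
   Context: $\pi(x)$ denotes the prime-counting function, i.e. the number of primes $p \leq x$. $\lfloor x \rfloor$ is the floor function, and $a \bmod b$ denotes the remainder of $a$ on division by $b$, so $0 \leq a \bmod b < b$. Natural numbers are positive integers. For natural numbers $M_1, M_2, n$, the integer $\phi_T(M_1, M_2, \pi(n))$ is defined by $$\phi_T(M_1, M_2, \pi(n)) := \sum_{p_i \leq n} \left\lfloor \frac{M_1 \bmod p_i + M_2 \bmod p_i}{p_i} \right\rfloor - \sum_{p_i < p_j \leq n} \left\lfloor \frac{M_1 \bmod p_i p_j + M_2 \bmod p_i p_j}{p_i p_j} \right\rfloor + \sum_{p_i < p_j < p_k \leq n} \left\lfloor \frac{M_1 \bmod p_i p_j p_k + M_2 \bmod p_i p_j p_k}{p_i p_j p_k} \right\rfloor - \cdots,$$ where $p_i, p_j, p_k, \dots$ range over the primes less than or equal to $n$. Here $M \bmod p_i p_j$ means $M \bmod (p_i p_j)$, and similarly for longer products. Equivalently, writing $\beta_S = \prod_{p \in S} p$, $$\phi_T(M_1, M_2, \pi(n)) = \sum_{\emptyset \neq S} (-1)^{|S|+1} \left\lfloor \frac{(M_1 \bmod \beta_S) + (M_2 \bmod \beta_S)}{\beta_S} \right\rfloor,$$ where $S$ runs over all nonempty subsets of the set of primes $\leq n$ (an empty sum, as for $n = 1$, is $0$). *)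

theory Defs
  imports Complex_Main "HOL-Computational_Algebra.Primes"
begin

definition primes_upto :: "nat \<Rightarrow> nat set" where
  "primes_upto x = {p. prime p \<and> p \<le> x}"

definition prime_pi :: "nat \<Rightarrow> nat" where
  "prime_pi x = card (primes_upto x)"

(* The literature writes phi_T(M1, M2, pi(n)): the third argument gives the number of
   leading primes in play. Those are exactly the primes up to n, so n itself is the
   parameter here. The term for S carries the sign (-1)^(card S + 1), grouping the
   alternating sums over p_i, p_i < p_j, p_i < p_j < p_k, ... into a single sum over
   nonempty sets of primes. *)
definition phi_T :: "nat \<Rightarrow> nat \<Rightarrow> nat \<Rightarrow> int" where
  "phi_T M1 M2 n =
     (\<Sum>S \<in> Pow (primes_upto n) - {{}}.
        (-1) ^ (card S + 1) * \<lfloor>real (M1 mod \<Prod>S + M2 mod \<Prod>S) / real (\<Prod>S)\<rfloor>)"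

end

theory Submission
  imports Defs
begin

text \<open>
  The identity compares three instances of Legendre's formula. Let \<open>A x\<close> be the number of
  \<open>m\<close> in \<open>{1..x}\<close> that no prime up to \<open>n\<close> divides. Inclusion-exclusion writes \<open>A x\<close> as the
  alternating sum of \<open>x div \<Prod>S\<close> over all sets \<open>S\<close> of primes up to \<open>n\<close>
  (\<open>legendre_formula\<close>). Adding two numbers modulo \<open>d\<close> produces a carry, which is the floor
  in \<open>phi_T\<close>, and this carry is exactly the defect of additivity of \<open>x div d\<close>. Hence
  \<open>phi_T\<close> is the defect of additivity of \<open>A\<close>, up to sign:
  \<open>A (M1 + M2) = A M1 + A M2 - phi_T M1 M2 n\<close> (\<open>sifted_count_add\<close>).

  On the other hand, for \<open>n \<le> x < (n + 1)\<^sup>2\<close> the survivors of the sieve are \<open>1\<close> and the primes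
  in \<open>{n<..x}\<close>, so \<open>A x = 1 + prime_pi x - prime_pi n\<close> (\<open>sifted_count_eq_prime_pi\<close>). All of
  \<open>n\<^sup>2\<close>, \<open>2 * n\<close> and their sum \<open>(n + 1)\<^sup>2 - 1\<close> lie in this range. The theorem is the addition
  formula for \<open>M1 = n\<^sup>2\<close> and \<open>M2 = 2 * n\<close>, as \<open>(n + 1)\<^sup>2\<close> itself is not prime.
\<close>

lemma finite_primes_upto [simp]: "finite (primes_upto x)"
  by (rule finite_subset[of _ "{..x}"]) (auto simp: primes_upto_def)

text \<open>The number of multiples of \<open>d\<close> is written as a sum of indicators so that it can be
  exchanged with the sum over sets of primes.\<close>

lemma int_div_eq_sum_multiples:
  fixes x d :: nat
  shows "int (x div d) = (\<Sum>m=1..x. of_bool (d dvd m))"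
  by (induction x) (auto simp: div_Suc dvd_eq_mod_eq_0)

lemma prod_primes_dvd_iff:
  fixes m :: nat
  assumes "finite S" "\<And>p. p \<in> S \<Longrightarrow> prime p"
  shows "\<Prod>S dvd m \<longleftrightarrow> (\<forall>p\<in>S. p dvd m)"
  using assms
proof (induction S rule: finite_induct)
  case (insert p S)
  have "coprime p (\<Prod>S)"
    using insert by (intro prod_coprime_right) (auto intro!: primes_coprime)
  then have "p * \<Prod>S dvd m \<longleftrightarrow> p dvd m \<and> \<Prod>S dvd m"
    by (auto intro: divides_mult dvd_mult_left dvd_mult_right)
  with insert show ?case by simp
qed simp

definition sifted_count :: "nat set \<Rightarrow> nat \<Rightarrow> nat" where
  "sifted_count P x = card {m \<in> {1..x}. \<forall>p\<in>P. \<not> p dvd m}"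

text \<open>For a single \<open>m\<close>, expand the product of the factors \<open>1 - of_bool (p dvd m)\<close> over the sieving
  primes, which is the indicator of survival; then sum over \<open>m\<close>.\<close>

lemma legendre_formula:
  assumes "finite P" "\<And>p. p \<in> P \<Longrightarrow> prime p"
  shows "int (sifted_count P x) = (\<Sum>S\<in>Pow P. (-1) ^ card S * int (x div \<Prod>S))"
proof -
  have survives: "of_bool (\<forall>p\<in>P. \<not> p dvd m) = (\<Sum>S\<in>Pow P. (-1) ^ card S * of_bool (\<Prod>S dvd m) :: int)"
    for m :: nat
  proof -
    have of_bool_ball: "(\<Prod>p\<in>S. of_bool (Q p)) = (of_bool (\<forall>p\<in>S. Q p) :: int)"
      if "finite S" for S :: "nat set" and Q
      using that by (induction S rule: finite_induct) auto
    have "of_bool (\<forall>p\<in>P. \<not> p dvd m) = (\<Prod>p\<in>P. 1 - of_bool (p dvd m) :: int)"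
      by (simp flip: of_bool_ball[OF assms(1)] add: of_bool_not_iff)
    also have "\<dots> = (\<Sum>S\<in>Pow P. (-1) ^ card S * (\<Prod>p\<in>S. of_bool (p dvd m)))"
      by (simp add: prod_diff_conv_sum[OF assms(1)])
    also have "\<dots> = (\<Sum>S\<in>Pow P. (-1) ^ card S * of_bool (\<Prod>S dvd m))"
    proof (rule sum.cong[OF refl])
      fix S assume "S \<in> Pow P"
      then have S: "finite S" "\<And>p. p \<in> S \<Longrightarrow> prime p"
        using assms finite_subset by auto
      show "(-1) ^ card S * (\<Prod>p\<in>S. of_bool (p dvd m)) = (-1) ^ card S * (of_bool (\<Prod>S dvd m) :: int)"
        using of_bool_ball[OF S(1)] prod_primes_dvd_iff[OF S] by simp
    qed
    finally show ?thesis .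
  qed
  have "int (sifted_count P x) = (\<Sum>m=1..x. of_bool (\<forall>p\<in>P. \<not> p dvd m))"
    by (simp add: sifted_count_def sum.If_cases of_bool_def Int_def)
  also have "\<dots> = (\<Sum>S\<in>Pow P. \<Sum>m=1..x. (-1) ^ card S * of_bool (\<Prod>S dvd m))"
    by (simp only: survives) (rule sum.swap)
  also have "\<dots> = (\<Sum>S\<in>Pow P. (-1) ^ card S * int (x div \<Prod>S))"
    by (simp only: int_div_eq_sum_multiples sum_distrib_left)
  finally show ?thesis .
qed

text \<open>The carry in \<open>phi_T\<close> is the third term of the division rule
  \<open>(a + b) div d = a div d + b div d + (a mod d + b mod d) div d\<close>.\<close>

lemma sifted_count_add:
  "int (sifted_count (primes_upto n) (M1 + M2)) =
   int (sifted_count (primes_upto n) M1) + int (sifted_count (primes_upto n) M2) - phi_T M1 M2 n"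
proof -
  let ?P = "primes_upto n"
  let ?carry = "\<lambda>S. (-1) ^ card S * int ((M1 mod \<Prod>S + M2 mod \<Prod>S) div \<Prod>S)"
  have prime: "prime p" if "p \<in> ?P" for p
    using that by (simp add: primes_upto_def)
  note legendre = legendre_formula[OF finite_primes_upto prime]
  have "phi_T M1 M2 n = - (\<Sum>S\<in>Pow ?P - {{}}. ?carry S)"
    by (simp add: phi_T_def floor_divide_of_nat_eq sum_negf del: of_nat_add of_nat_prod)
  \<comment> \<open>The empty set has product \<open>1\<close>, and there is no carry modulo \<open>1\<close>.\<close>
  also have "\<dots> = - (\<Sum>S\<in>Pow ?P. ?carry S)"
    by (subst sum.remove[of _ "{}"]) auto
  finally have "phi_T M1 M2 n = - (\<Sum>S\<in>Pow ?P. ?carry S)" .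
  moreover have "int (sifted_count ?P (M1 + M2)) =
      (\<Sum>S\<in>Pow ?P. (-1) ^ card S * int (M1 div \<Prod>S) + (-1) ^ card S * int (M2 div \<Prod>S) + ?carry S)"
    by (subst legendre) (simp_all add: div_add1_eq[of M1 M2] distrib_left)
  ultimately show ?thesis
    by (simp add: legendre sum.distrib)
qed

text \<open>A composite number below \<open>(n + 1)\<^sup>2\<close> has a prime factor at most its square root, which the
  sieve detects.\<close>

lemma sifted_eq_one_and_primes:
  assumes "x < (n + 1)^2" "n \<le> x" "1 \<le> x"
  shows "{m \<in> {1..x}. \<forall>p\<in>primes_upto n. \<not> p dvd m} = insert 1 (primes_upto x - primes_upto n)"
proof (intro equalityI subsetI)
  fix m assume "m \<in> {m \<in> {1..x}. \<forall>p\<in>primes_upto n. \<not> p dvd m}"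
  then have m: "1 \<le> m" "m \<le> x" and sifted: "\<And>p. prime p \<Longrightarrow> p \<le> n \<Longrightarrow> \<not> p dvd m"
    by (auto simp: primes_upto_def)
  show "m \<in> insert 1 (primes_upto x - primes_upto n)"
  proof (cases "m = 1")
    case False
    then obtain p where p: "prime p" "p dvd m"
      using prime_factor_nat by blast
    then obtain k where k: "m = p * k" by blast
    have "k = 1"
    proof (rule ccontr)
      assume "k \<noteq> 1"
      then obtain q where q: "prime q" "q dvd k"
        using prime_factor_nat by blast
      have "n + 1 \<le> p" "n + 1 \<le> q"
        using sifted p q k by (metis dvd_mult Suc_eq_plus1 not_less_eq_eq)+
      moreover have "q \<le> k" using q m k by (auto intro: dvd_imp_le)
      ultimately have "(n + 1)^2 \<le> m"
        unfolding k power2_eq_square by (intro mult_le_mono) auto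
      with m assms show False by simp
    qed
    with k p m sifted[of p] show ?thesis by (auto simp: primes_upto_def)
  qed simp
next
  fix m assume "m \<in> insert 1 (primes_upto x - primes_upto n)"
  then show "m \<in> {m \<in> {1..x}. \<forall>p\<in>primes_upto n. \<not> p dvd m}"
    using assms by (auto simp: primes_upto_def prime_ge_1_nat dest: primes_dvd_imp_eq)
qed

lemma sifted_count_eq_prime_pi:
  assumes "x < (n + 1)^2" "n \<le> x" "1 \<le> x"
  shows "int (sifted_count (primes_upto n) x) = 1 + int (prime_pi x) - int (prime_pi n)"
proof -
  have sub: "primes_upto n \<subseteq> primes_upto x"
    using assms by (auto simp: primes_upto_def)
  have "1 \<notin> primes_upto x - primes_upto n"
    by (simp add: primes_upto_def)
  then have "sifted_count (primes_upto n) x = Suc (prime_pi x - prime_pi n)"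
    unfolding sifted_count_def sifted_eq_one_and_primes[OF assms]
    by (simp add: prime_pi_def card_Diff_subset sub)
  moreover have "prime_pi n \<le> prime_pi x"
    unfolding prime_pi_def by (rule card_mono) (use sub in auto)
  ultimately show ?thesis by simp
qed

theorem theorem1:
  fixes n :: nat
  assumes "n \<ge> 1"
  shows "int (prime_pi ((n + 1)^2)) - int (prime_pi (n^2)) =
         int (prime_pi (2 * n)) - int (prime_pi n) + 1 - phi_T (n^2) (2 * n) n"
proof -
  have square: "(n + 1)^2 = n^2 + 2 * n + 1"
    by (simp add: power2_eq_square)
  have "\<not> prime ((n + 1)^2)"
    by (simp add: prime_power_iff)
  then have "primes_upto ((n + 1)^2) = primes_upto (n^2 + 2 * n)"
    unfolding primes_upto_def square using le_Suc_eq by fastforce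
  then have "prime_pi ((n + 1)^2) = prime_pi (n^2 + 2 * n)"
    by (simp add: prime_pi_def)
  moreover have "int (sifted_count (primes_upto n) x) = 1 + int (prime_pi x) - int (prime_pi n)"
    if "x \<in> {n^2, 2 * n, n^2 + 2 * n}" for x
  proof (rule sifted_count_eq_prime_pi)
    show "x < (n + 1)^2" "n \<le> x" "1 \<le> x"
      using that assms unfolding square by (auto simp: power2_eq_square)
  qed
  ultimately show ?thesis
    using sifted_count_add[of n "n^2" "2 * n"] by simp
qed

end
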